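(* Let $q$ be a prime and let $p$ be a prime that is a primitive root modulo $q$ (i.e., $p \bmod q$ generates the cyclic group $\mathbb F_q^*$). Let $\mathbf w=\langle w_0,\dots,w_{q-1}\rangle\in\mathbb F_p^q$. Suppose $w_0+w_1+\cdots+w_{q-1}\ne 0$ and the $w_i$ are not all equal. Then the $\mathbb F_p$-vector space spanned by the cyclic shifts $\mathbf w,\mathbf w^{\oslash},\dots,\mathbf w^{\oslash^{q-1}}$ has dimension $q$.
   Context: For $\mathbf w=\langle w_0,\dots,w_{q-1}\rangle$, the cyclic shift is $\mathbf w^{\oslash}=\langle w_{q-1},w_0,\dots,w_{q-2}\rangle$, and $\mathbf w^{\oslash^a}$ denotes $a$-fold iteration. *)

theory Defs
  imports
    "Jordan_Normal_Form.VS_Connect"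
    "Berlekamp_Zassenhaus.Finite_Field"
    "HOL-Number_Theory.Residue_Primitive_Roots"
begin

definition cyclic_shift :: "'a vec \<Rightarrow> 'a vec" where
  "cyclic_shift w =
     vec (dim_vec w) (\<lambda>i. if i = 0 then w $ (dim_vec w - 1) else w $ (i - 1))"

text \<open>The library's \<open>dim\<close> lives in a locale over explicit
  carriers; \<open>vs_span_dim n S\<close> is the dimension over the field \<open>'a\<close> of the subspace
  of \<open>'a\<^sup>n\<close> generated by \<open>S \<subseteq> carrier_vec n\<close>.\<close>

definition vs_span_dim :: "nat \<Rightarrow> 'a::field vec set \<Rightarrow> nat" where
  "vs_span_dim n S =
     vectorspace.dim (class_ring :: 'a ring)
       (module.span_vs class_ring (module_vec TYPE('a) n) S)"

end

theory Submission
  imports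
    Defs
    "Berlekamp_Zassenhaus.Distinct_Degree_Factorization"
    "Jordan_Normal_Form.DL_Rank"
begin

text \<open>
  Identify \<open>w\<close> with \<open>W = w\<^sub>0 + w\<^sub>1 X + \<dots> + w\<^bsub>q-1\<^esub> X\<^bsup>q-1\<^esup>\<close>, so that the shift becomes
  multiplication by \<open>X\<close> modulo \<open>X\<^sup>q - 1\<close>. Let \<open>f\<close> be an irreducible common factor of \<open>W\<close>
  and \<open>X\<^sup>q - 1\<close>. If \<open>f\<close> divides \<open>X - 1\<close>, then \<open>W(1) = 0\<close>. Otherwise the residue of \<open>X\<close>
  modulo \<open>f\<close> has order \<open>q\<close> in a field with \<open>p\<^bsup>deg f\<^esup>\<close> elements, so \<open>q\<close> divides
  \<open>p\<^bsup>deg f\<^esup> - 1\<close> and hence \<open>q - 1\<close> divides \<open>deg f\<close>; for degree reasons \<open>W\<close> and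
  \<open>1 + X + \<dots> + X\<^bsup>q-1\<^esup>\<close> are both constant multiples of \<open>f\<close>, and all \<open>w\<^sub>i\<close> are equal.
  So \<open>W\<close> is coprime to \<open>X\<^sup>q - 1\<close>, and a linear relation among the shifts, which says
  that \<open>X\<^sup>q - 1\<close> divides \<open>V W\<close> for some \<open>V\<close> of degree less than \<open>q\<close>, is trivial.
\<close>

definition vec_poly :: "'a::comm_monoid_add vec \<Rightarrow> 'a poly" where
  "vec_poly v = (\<Sum>i<dim_vec v. Polynomial.monom (v $ i) i)"

lemma coeff_vec_poly: "Polynomial.coeff (vec_poly v) i = (if i < dim_vec v then v $ i else 0)"
  by (simp add: vec_poly_def Polynomial.coeff_sum)

lemma degree_vec_poly_less: "0 < dim_vec v \<Longrightarrow> degree (vec_poly v) < dim_vec v"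
  by (rule degree_lessI) (auto simp: coeff_vec_poly)

lemma vec_poly_eq_0_iff: "vec_poly v = 0 \<longleftrightarrow> v = 0\<^sub>v (dim_vec v)"
  by (auto simp: poly_eq_iff coeff_vec_poly vec_eq_iff)

lemma poly_vec_poly_1: "poly (vec_poly (v :: 'a::comm_semiring_1 vec)) 1 = (\<Sum>i<dim_vec v. v $ i)"
  by (simp add: vec_poly_def poly_sum poly_monom)

lemma monom_1_power: "Polynomial.monom (1::'a::comm_semiring_1) 1 ^ n = Polynomial.monom 1 n"
  by (simp add: monom_power)

text \<open>Since \<open>X^q\<close> is 1 modulo \<open>X^q - 1\<close>, exponents matter only
  modulo \<open>q\<close>.\<close>

lemma monom_diff_mod_dvd:
  "(Polynomial.monom 1 q - 1 :: 'a::comm_ring_1 poly) dvd Polynomial.monom c n - Polynomial.monom c (n mod q)"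
proof -
  have "Polynomial.monom c n = Polynomial.monom c (n mod q) * Polynomial.monom 1 q ^ (n div q)"
    by (simp add: monom_power mult_monom)
  hence "Polynomial.monom c n - Polynomial.monom c (n mod q)
      = Polynomial.monom c (n mod q) * (Polynomial.monom 1 q ^ (n div q) - 1)"
    by (simp add: algebra_simps)
  thus ?thesis
    by (metis dvd_mult dvd_triv_left power_diff_1_eq)
qed

text \<open>Euclid's algorithm on the exponents: if \<open>x^m\<close> and \<open>x^n\<close> are
  both 1 modulo \<open>f\<close>, so is \<open>x^(m mod n)\<close>.\<close>

lemma dvd_power_gcd_diff_1:
  fixes f x :: "'a::comm_ring_1"
  assumes "f dvd x ^ m - 1" "f dvd x ^ n - 1"
  shows "f dvd x ^ gcd m n - 1"
  using assms
proof (induction m n rule: gcd_nat_induct)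
  case (step m n)
  have "x ^ m = x ^ (m mod n) * (x ^ n) ^ (m div n)"
    by (simp flip: power_mult power_add)
  hence "x ^ (m mod n) - 1 = (x ^ m - 1) - x ^ (m mod n) * ((x ^ n) ^ (m div n) - 1)"
    by (simp add: algebra_simps)
  moreover have "f dvd (x ^ n) ^ (m div n) - 1"
    using step.prems(2) by (metis dvd_mult2 power_diff_1_eq)
  ultimately have "f dvd x ^ (m mod n) - 1"
    using step.prems(1) by (metis dvd_diff dvd_mult)
  with step show ?case
    by (simp add: gcd_red_nat[of m n])
qed simp

text \<open>Modulo \<open>f\<close>, both the exponents \<open>q\<close> and
  \<open>p^deg f - 1\<close> send \<open>X\<close> to 1; were they coprime, \<open>f\<close> would
  divide \<open>X - 1\<close>.\<close>

lemma ord_dvd_degree_of_cyclotomic_factor: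
  fixes f :: "'p::prime_card mod_ring poly"
  assumes q: "prime q" and f: "irreducible f"
    and fq: "f dvd Polynomial.monom 1 q - 1" and f1: "\<not> f dvd Polynomial.monom 1 1 - 1"
  shows "ord q CARD('p) dvd degree f"
proof -
  define x :: "'p mod_ring poly" where "x = Polynomial.monom 1 1"
  define N where "N = CARD('p) ^ degree f"
  have N: "N > 0"
    by (simp add: N_def)
  have xq: "f dvd x ^ q - 1"
    using fq by (simp add: x_def monom_1_power del: One_nat_def)
  have f_x: "\<not> f dvd x"
  proof
    assume "f dvd x"
    hence "f dvd x ^ q"
      using prime_gt_0_nat[OF q] by (metis dvd_power dvd_trans)
    hence "f dvd 1"
      using xq by (metis dvd_diffD1 dvd_diff diff_diff_eq2 add_diff_cancel_left')
    thus False
      using f by (simp add: irreducible_def)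
  qed
  have "x ^ N - x = x * (x ^ (N - 1) - 1)"
    using N by (simp add: algebra_simps flip: power_Suc)
  \<comment> \<open>The residue field of \<open>f\<close> has \<open>N\<close> elements, so each of
    them equals its own \<open>N\<close>-th power.\<close>
  moreover have "f dvd x ^ N - x"
    using degree_divisor1[OF f refl] by (simp add: x_def N_def)
  ultimately have xN: "f dvd x ^ (N - 1) - 1"
    using f f_x by (metis irreducible_imp_prime_elem prime_elem_dvd_mult_iff)
  have "q dvd N - 1"
  proof (rule ccontr)
    assume "\<not> q dvd N - 1"
    hence "gcd q (N - 1) = 1"
      using q by (metis prime_imp_coprime coprime_imp_gcd_eq_1)
    with dvd_power_gcd_diff_1[OF xq xN] f1 show False
      by (simp add: x_def)
  qed
  hence "[N = 1] (mod q)"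
    using N by (simp add: cong_altdef_nat)
  thus ?thesis
    unfolding N_def by (rule iffD1[OF ord_divides])
qed

lemma vec_poly_coprime_cyclotomic:
  fixes w :: "'p::prime_card mod_ring vec"
  assumes q: "prime q" and pr: "residue_primroot q CARD('p)" and w: "w \<in> carrier_vec q"
    and s: "(\<Sum>i<q. w $ i) \<noteq> 0" and ne: "\<not> (\<forall>i<q. \<forall>j<q. w $ i = w $ j)"
  shows "algebraic_semidom_class.coprime (Polynomial.monom 1 q - 1) (vec_poly w)"
proof (rule ccontr)
  let ?W = "vec_poly w" and ?x = "Polynomial.monom 1 1 :: 'p mod_ring poly"
  \<comment> \<open>\<open>F\<close> is \<open>1 + X + ... + X^(q-1)\<close>, the cofactor of
    \<open>X - 1\<close> in \<open>X^q - 1\<close>.\<close>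
  define F :: "'p mod_ring poly" where "F = vec_poly (vec q (\<lambda>_. 1))"
  have q0: "q > 0" and dw: "dim_vec w = q"
    using prime_gt_0_nat[OF q] w by auto
  have W1: "poly ?W 1 \<noteq> 0"
    using s by (simp add: poly_vec_poly_1 dw)
  hence W0: "?W \<noteq> 0"
    by auto
  have F0: "F \<noteq> 0"
  proof
    assume "F = 0"
    hence "Polynomial.coeff F 0 = 0" by simp
    thus False using q0 by (simp add: F_def coeff_vec_poly)
  qed
  assume "\<not> algebraic_semidom_class.coprime (Polynomial.monom 1 q - 1) ?W"
  then obtain g where g: "g dvd Polynomial.monom 1 q - 1" "g dvd ?W" "\<not> is_unit g"
    by (auto elim: not_coprimeE)
  moreover have "g \<noteq> 0"
    using g W0 by auto
  ultimately obtain f where f: "prime f" "f dvd g"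
    by (metis prime_divisor_exists)
  have irr: "irreducible f"
    using f(1) by blast
  have fq: "f dvd Polynomial.monom 1 q - 1" and fW: "f dvd ?W"
    using f g by (auto intro: dvd_trans)
  \<comment> \<open>By degrees such an \<open>f\<close> would be a constant multiple of
    \<open>X - 1\<close>, making 1 a root of \<open>?W\<close>, whose value there is the sum of the
    entries.\<close>
  have f1: "\<not> f dvd ?x - 1"
  proof
    assume "f dvd ?x - 1"
    then obtain h where h: "?x - 1 = f * h" by (elim dvdE)
    have "?x - 1 = [:-1, 1:]"
      by (rule poly_eqI) (auto simp: coeff_pCons split: nat.split)
    hence fh: "f * h = [:-1, 1:]"
      using h by simp
    have "degree (f * h) = 1" "poly (f * h) 1 = 0"
      unfolding fh by simp_all
    moreover have "f \<noteq> 0" "h \<noteq> 0"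
      using \<open>degree (f * h) = 1\<close> by auto
    moreover have "degree f \<noteq> 0"
      using irr \<open>f \<noteq> 0\<close> by (auto simp: irreducible_def is_unit_iff_degree)
    ultimately have "degree h = 0"
      by (simp add: degree_mult_eq)
    then obtain c where c: "h = [:c:]"
      by (metis degree_eq_zeroE)
    have "poly f 1 = 0"
      using \<open>poly (f * h) 1 = 0\<close> c \<open>h \<noteq> 0\<close> by auto
    with fW W1 show False
      by auto
  qed
  have "Polynomial.monom 1 q - 1 = (?x - 1) * F"
    using power_diff_1_eq[of ?x q] by (simp add: monom_1_power F_def vec_poly_def del: One_nat_def)
  hence fF: "f dvd F"
    using fq f f1 by (metis prime_dvd_mult_iff)
  have "ord q CARD('p) = q - 1"
    using pr q by (simp add: residue_primroot_def totient_prime)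
  hence "q - 1 dvd degree f"
    using ord_dvd_degree_of_cyclotomic_factor[OF q irr fq f1] by simp
  moreover have "degree f \<noteq> 0"
    using irr W0 fW by (auto simp: irreducible_def is_unit_iff_degree)
  ultimately have df: "q - 1 \<le> degree f"
    by (simp add: dvd_imp_le)
  \<comment> \<open>If \<open>f\<close> has degree at least \<open>q - 1\<close>, a nonzero multiple
    of degree below \<open>q\<close> leaves only a constant cofactor.\<close>
  have const: "\<exists>c. G = Polynomial.smult c f" if "f dvd G" "G \<noteq> 0" "degree G < q" for G
  proof -
    from \<open>f dvd G\<close> obtain h where h: "G = f * h" by (elim dvdE)
    have "degree G = degree f + degree h"
      using h that by (auto simp: degree_mult_eq)
    hence "degree h = 0"
      using df that by linarith
    thus ?thesis
      using h by (metis degree_eq_zeroE mult.commute mult_pCons_left mult_zero_left pCons_0_0 add_0_right)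
  qed
  obtain c where c: "?W = Polynomial.smult c f"
    using const[OF fW W0] degree_vec_poly_less[of w] q0 dw by auto
  obtain d where d: "F = Polynomial.smult d f"
    using const[OF fF F0] degree_vec_poly_less[of "vec q (\<lambda>_. 1::'p mod_ring)"] q0
    by (auto simp: F_def)
  have "w $ i = c / d" if "i < q" for i
  proof -
    \<comment> \<open>All coefficients of \<open>F\<close> are 1, so \<open>d\<close> is invertible
      and every coefficient of \<open>f\<close> up to index \<open>q - 1\<close> is its
      inverse.\<close>
    have "d * Polynomial.coeff f i = 1"
      using arg_cong[OF d, of "\<lambda>P. Polynomial.coeff P i"] that by (simp add: F_def coeff_vec_poly)
    moreover have "w $ i = c * Polynomial.coeff f i"
      using arg_cong[OF c, of "\<lambda>P. Polynomial.coeff P i"] that by (simp add: dw coeff_vec_poly)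
    ultimately show ?thesis
      by (metis divide_inverse inverse_unique)
  qed
  with ne show False by simp
qed

text \<open>Entry \<open>i\<close> comes from index \<open>i - a\<close> modulo \<open>q\<close>;
  adding \<open>q - a\<close> instead avoids truncated subtraction.\<close>

lemma cyclic_shift_funpow:
  assumes "w \<in> carrier_vec q" "a \<le> q"
  shows "(cyclic_shift ^^ a) w = vec q (\<lambda>i. w $ ((i + (q - a)) mod q))"
  using assms(2)
proof (induction a)
  case 0
  thus ?case using assms(1) by (auto simp: vec_eq_iff)
next
  case (Suc a)
  hence q: "Suc a \<le> q" by simp
  \<comment> \<open>Wrapping around at \<open>i = 0\<close> costs exactly one extra
    \<open>q\<close>, which vanishes modulo \<open>q\<close>.\<close>
  have "(if i = 0 then q - 1 else i - 1) + (q - a) = i + (q - Suc a) + (if i = 0 then q else 0)"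
    if "i < q" for i
    using that q by auto
  hence mod_eq: "((if i = 0 then q - 1 else i - 1) + (q - a)) mod q = (i + (q - Suc a)) mod q"
    if "i < q" for i
    using that by (simp split: if_splits)
  have "cyclic_shift (vec q (\<lambda>i. w $ ((i + (q - a)) mod q)))
      = vec q (\<lambda>i. w $ (((if i = 0 then q - 1 else i - 1) + (q - a)) mod q))"
    by (intro eq_vecI) (auto simp: cyclic_shift_def)
  also have "\<dots> = vec q (\<lambda>i. w $ ((i + (q - Suc a)) mod q))"
    by (intro eq_vecI) (simp_all only: mod_eq index_vec dim_vec)
  finally have "cyclic_shift (vec q (\<lambda>i. w $ ((i + (q - a)) mod q))) = \<dots>" .
  with Suc show ?case
    by simp
qed

lemma bij_betw_add_mod:
  assumes "a < (q::nat)"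
  shows "bij_betw (\<lambda>i. (i + (q - a)) mod q) {..<q} {..<q}"
proof (rule bij_betw_byWitness[where f' = "\<lambda>i. (i + a) mod q"])
  show "\<forall>i\<in>{..<q}. ((i + (q - a)) mod q + a) mod q = i"
    using assms by (simp add: mod_simps)
  show "\<forall>i\<in>{..<q}. ((i + a) mod q + (q - a)) mod q = i"
    using assms by (simp only: mod_add_left_eq) simp
qed (use assms in auto)

text \<open>Modulo \<open>X^q - 1\<close> the \<open>a\<close>-th shift is multiplication by
  \<open>X^a\<close>, so combining the shifts with coefficients \<open>v\<close> amounts to
  multiplying by \<open>vec_poly v\<close>.\<close>

lemma vec_poly_mult_cong_shifts:
  fixes v w :: "'a::comm_ring_1 vec"
  assumes v: "v \<in> carrier_vec q" and w: "w \<in> carrier_vec q"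
  shows "Polynomial.monom 1 q - 1 dvd vec_poly v * vec_poly w -
    vec_poly (vec q (\<lambda>i. \<Sum>a<q. (cyclic_shift ^^ a) w $ i * v $ a))"
proof -
  let ?t = "\<lambda>a i. (i + (q - a)) mod q"
  have "vec_poly v * vec_poly w = (\<Sum>a<q. \<Sum>j<q. Polynomial.monom (v $ a * w $ j) (a + j))"
    using v w by (simp add: vec_poly_def sum_product mult_monom)
  \<comment> \<open>For fixed \<open>a\<close>, substitute \<open>j = ?t a i\<close>: then
    \<open>a + j\<close> is congruent to \<open>i\<close> modulo \<open>q\<close>.\<close>
  also have "\<dots> = (\<Sum>a<q. \<Sum>i<q. Polynomial.monom (v $ a * w $ ?t a i) (a + ?t a i))"
    by (intro sum.cong refl sum.reindex_bij_betw[symmetric] bij_betw_add_mod) simp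
  finally have 1: "vec_poly v * vec_poly w = \<dots>" .
  have "vec_poly (vec q (\<lambda>i. \<Sum>a<q. (cyclic_shift ^^ a) w $ i * v $ a))
      = (\<Sum>i<q. \<Sum>a<q. Polynomial.monom (v $ a * w $ ?t a i) i)"
    by (simp add: vec_poly_def cyclic_shift_funpow[OF w] mult.commute
        flip: monom_sum)
  also have "\<dots> = (\<Sum>a<q. \<Sum>i<q. Polynomial.monom (v $ a * w $ ?t a i) i)"
    by (rule sum.swap)
  finally have 2: "vec_poly (vec q (\<lambda>i. \<Sum>a<q. (cyclic_shift ^^ a) w $ i * v $ a)) = \<dots>" .
  have "Polynomial.monom 1 q - 1 dvd
      Polynomial.monom (v $ a * w $ ?t a i) (a + ?t a i) - Polynomial.monom (v $ a * w $ ?t a i) i"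
    if "a < q" "i < q" for a i
  proof -
    have "(a + ?t a i) mod q = i"
      using that by (simp add: mod_simps)
    thus ?thesis
      using monom_diff_mod_dvd by metis
  qed
  thus ?thesis
    unfolding 1 2 sum_subtractf[symmetric] by (intro dvd_sum) auto
qed

theorem theorem3:
  fixes p q :: nat
    and w :: "'p::prime_card mod_ring vec"
  assumes "prime q"
    and "prime p"
    and "p = CARD('p)"
    and "residue_primroot q p"
    and "w \<in> carrier_vec q"
    and "(\<Sum>i<q. w $ i) \<noteq> 0"
    and "\<not> (\<forall>i<q. \<forall>j<q. w $ i = w $ j)"
  shows "vs_span_dim q ((\<lambda>a. (cyclic_shift ^^ a) w) ` {..<q}) = q"
proof -
  interpret vec_space "TYPE('p mod_ring)" q .
  let ?s = "\<lambda>a. (cyclic_shift ^^ a) w"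
  \<comment> \<open>The shifts are the columns of \<open>A\<close>, so a kernel vector is a linear
    relation among them.\<close>
  define A where "A = mat_of_cols q (map ?s [0..<q])"
  have q0: "q > 0"
    using assms(1) by (rule prime_gt_0_nat)
  have A: "A \<in> carrier_mat q q"
    using mat_of_cols_carrier(1)[of q "map ?s [0..<q]"] by (simp add: A_def)
  have s: "?s a \<in> carrier_vec q" if "a < q" for a
    using that by (simp add: cyclic_shift_funpow[OF assms(5)])
  have "det A \<noteq> 0"
  proof
    assume "det A = 0"
    then obtain v where v: "v \<in> carrier_vec q" "v \<noteq> 0\<^sub>v q" "A *\<^sub>v v = 0\<^sub>v q"
      using det_0_iff_vec_prod_zero_field[OF A] by auto
    have "A *\<^sub>v v = vec q (\<lambda>i. \<Sum>a<q. ?s a $ i * v $ a)"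
      using v(1) by (auto simp: vec_eq_iff A_def scalar_prod_def mat_of_cols_index atLeast0LessThan)
    hence "vec_poly (vec q (\<lambda>i. \<Sum>a<q. ?s a $ i * v $ a)) = 0"
      using v(3) by (simp add: vec_poly_eq_0_iff)
    hence "Polynomial.monom 1 q - 1 dvd vec_poly v * vec_poly w"
      using vec_poly_mult_cong_shifts[OF v(1) assms(5)] by simp
    hence dvd: "Polynomial.monom 1 q - 1 dvd vec_poly v"
      using vec_poly_coprime_cyclotomic[OF assms(1) _ assms(5-7)] assms(3,4)
      by (simp add: coprime_dvd_mult_left_iff)
    have "Polynomial.coeff (Polynomial.monom 1 q - 1 :: 'p mod_ring poly) q \<noteq> 0"
      using q0 by simp
    hence "q \<le> degree (Polynomial.monom 1 q - 1 :: 'p mod_ring poly)"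
      by (rule le_degree)
    moreover have "vec_poly v \<noteq> 0"
      using v by (simp add: vec_poly_eq_0_iff)
    ultimately have "q \<le> degree (vec_poly v)"
      using dvd by (meson dvd_imp_degree_le order_trans)
    thus False
      using degree_vec_poly_less[of v] v(1) q0 by simp
  qed
  \<comment> \<open>\<open>rank\<close> is the dimension of the span of the set of columns, so it
    remains to identify that set with the shifts.\<close>
  hence "rank A = q"
    using det_rank_iff[OF A] by simp
  moreover have "set (cols A) = ?s ` {..<q}"
    using s by (subst A_def, subst cols_mat_of_cols) auto
  ultimately show ?thesis
    by (simp add: vs_span_dim_def rank_def)
qed

end
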